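(* Let $n\ge 2$ be an integer, $\mathbf{p}\in\mathcal{P}_n$, and $\alpha\in(0,1)\cup(1,\infty)$. Let $p\in[0,\frac1n]$ and $p'\in[\frac1n,1]$ be chosen to satisfy $$\|\mathbf{v}_n(p)\|_\alpha = \|\mathbf{p}\|_\alpha = \|\mathbf{w}_n(p')\|_\alpha .$$ Then: if $0<\alpha<1$, then $H(\mathbf{v}_n(p)) \le H(\mathbf{p}) \le H(\mathbf{w}_n(p'))$; if $\alpha>1$, then $H(\mathbf{w}_n(p')) \le H(\mathbf{p}) \le H(\mathbf{v}_n(p))$.
   Context: $\mathcal{P}_n = \{(p_1,\dots,p_n)\in\mathbb{R}^n : p_i \ge 0,\ \sum_{i=1}^n p_i = 1\}$. The Shannon entropy is $H(\mathbf{p}) = -\sum_{i=1}^n p_i \ln p_i$ with $0\ln 0 = 0$ (natural logarithm). For $\alpha\in(0,\infty)$, $\|\mathbf{p}\|_\alpha = \bigl(\sum_{i=1}^n p_i^\alpha\bigr)^{1/\alpha}$. For $p\in[0,\frac1{n-1}]$, $\mathbf{v}_n(p) = (1-(n-1)p,\, p,\, \dots,\, p) \in \mathcal{P}_n$. For $p \in [\frac1n, 1]$, $\mathbf{w}_n(p) = (w_1(p),\dots,w_n(p)) \in \mathcal{P}_n$ with $w_i(p) = p$ if $1\le i\le \lfloor p^{-1}\rfloor$, $w_i(p) = 1-\lfloor p^{-1}\rfloor p$ if $i = \lfloor p^{-1}\rfloor + 1$, and $w_i(p)=0$ otherwise. *)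

theory Defs
  imports Complex_Main
begin

text \<open>
  A vector of \<open>\<real>\<^sup>n\<close> is represented by a function \<open>x :: nat \<Rightarrow> real\<close>, of which only the components
  \<open>x 1, \<dots>, x n\<close> matter: every notion below that takes \<open>n\<close> inspects \<open>x\<close> on \<open>{1..n}\<close> only.
\<close>

definition prob_simplex :: "nat \<Rightarrow> (nat \<Rightarrow> real) set" where
  "prob_simplex n = {x. (\<forall>i\<in>{1..n}. x i \<ge> 0) \<and> (\<Sum>i=1..n. x i) = 1}"

text \<open>The convention \<open>0 ln 0 = 0\<close> holds automatically, since \<open>0 * y = 0\<close>.\<close>

definition shannon_entropy :: "nat \<Rightarrow> (nat \<Rightarrow> real) \<Rightarrow> real" where
  "shannon_entropy n x = - (\<Sum>i=1..n. x i * ln (x i))"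

text \<open>
  For \<open>\<alpha> > 0\<close> and nonnegative components, \<open>powr\<close> is the usual real power; in particular
  \<open>0 powr \<alpha> = 0\<close>.
\<close>

definition alpha_norm :: "nat \<Rightarrow> real \<Rightarrow> (nat \<Rightarrow> real) \<Rightarrow> real" where
  "alpha_norm n \<alpha> x = (\<Sum>i=1..n. x i powr \<alpha>) powr (1 / \<alpha>)"

definition v_vec :: "nat \<Rightarrow> real \<Rightarrow> nat \<Rightarrow> real" where
  "v_vec n p i = (if i = 1 then 1 - (real n - 1) * p else p)"

text \<open>
  The components of the second vector do not depend on \<open>n\<close>. For \<open>p = 1 / n\<close> the index
  \<open>\<lfloor>1 / p\<rfloor> + 1 = n + 1\<close> lies outside \<open>{1..n}\<close>, and the component there is \<open>0\<close> anyway.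
\<close>

definition w_vec :: "real \<Rightarrow> nat \<Rightarrow> real" where
  "w_vec p i =
    (if 1 \<le> int i \<and> int i \<le> \<lfloor>1 / p\<rfloor> then p
     else if int i = \<lfloor>1 / p\<rfloor> + 1 then 1 - of_int \<lfloor>1 / p\<rfloor> * p
     else 0)"

lemma v_vec_in_prob_simplex:
  assumes "n \<ge> 2" and "0 \<le> p" and "p \<le> 1 / (real n - 1)"
  shows "v_vec n p \<in> prob_simplex n"
proof -
  have "(\<Sum>i=1..n. v_vec n p i) = v_vec n p 1 + (\<Sum>i=2..n. v_vec n p i)"
    using assms(1) by (simp add: sum.atLeast_Suc_atMost numeral_2_eq_2)
  also have "(\<Sum>i=2..n. v_vec n p i) = (\<Sum>i=2..n. p)"
    by (rule sum.cong) (auto simp: v_vec_def)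
  also have "\<dots> = (real n - 1) * p"
    using assms(1) by (simp add: of_nat_diff)
  finally have "(\<Sum>i=1..n. v_vec n p i) = 1"
    by (simp add: v_vec_def)
  moreover have "(real n - 1) * p \<le> 1"
    using assms by (simp add: field_simps)
  ultimately show ?thesis
    using assms(2) by (auto simp: prob_simplex_def v_vec_def)
qed

lemma w_vec_in_prob_simplex:
  assumes "n \<ge> 1" and "1 / real n \<le> p" and "p \<le> 1"
  shows "w_vec p \<in> prob_simplex n"
proof -
  have p: "p > 0"
    using assms(1,2) by (smt (verit) divide_pos_pos of_nat_0_less_iff less_le_trans zero_less_one of_nat_le_iff)
  define m where "m = nat \<lfloor>1 / p\<rfloor>"
  have m: "\<lfloor>1 / p\<rfloor> = int m"
    using p by (simp add: m_def)
  have "real m \<le> 1 / p"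
    using of_int_floor_le[of "1 / p"] m by simp
  then have mp: "real m * p \<le> 1"
    using p by (simp add: field_simps)
  have "1 / p \<le> real n"
    using assms(1,2) p by (simp add: field_simps)
  then have mn: "m \<le> n"
    using \<open>real m \<le> 1 / p\<close> by linarith
  have w: "w_vec p i = (if 1 \<le> i \<and> i \<le> m then p else if i = m + 1 then 1 - real m * p else 0)" for i
    unfolding w_vec_def m by auto
  have nonneg: "w_vec p i \<ge> 0" for i
    using p mp by (simp add: w)
  have low: "(\<Sum>i=1..m. w_vec p i) = real m * p"
    by (simp add: w)
  have "(\<Sum>i=1..n. w_vec p i) = 1"
  proof (cases "m = n")
    case True
    have "1 \<le> real n * p"
      using assms(1,2) by (simp add: field_simps)
    then show ?thesis
      using low mp True by simp
  next
    case False
    have "(\<Sum>i=1..n. w_vec p i) = (\<Sum>i=1..m+1. w_vec p i)"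
      using mn False by (intro sum.mono_neutral_right) (auto simp: w)
    also have "\<dots> = 1"
      using low by (simp add: w)
    finally show ?thesis .
  qed
  then show ?thesis
    using nonneg by (simp add: prob_simplex_def)
qed

end

theory Submission
  imports Defs "HOL-Analysis.Convex" "HOL-Real_Asymp.Real_Asymp"
begin

text \<open>
  Lagrangian certificates. Put \<open>h t = (\<alpha> - 1) (- t ln t) + l t\<^sup>\<alpha> + m t\<close>. In the variable
  \<open>ln t\<close>, the derivative of \<open>h\<close> is a linear function plus an exponential, so given
  \<open>0 < a < b\<close> the multipliers \<open>l, m\<close> can be chosen such that it is convex and vanishes exactly at
  \<open>ln a\<close> and \<open>ln b\<close>; then \<open>h\<close> increases up to \<open>a\<close>, decreases from \<open>a\<close> to \<open>b\<close>, and increases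
  from \<open>b\<close> on. Two vectors with equal sum and equal \<open>\<alpha>\<close>-norm have their entropies compared as soon
  as the sums of \<open>h\<close> over their components are compared, and this can be done componentwise:
  for \<open>v\<^sub>n(p)\<close> take \<open>a = p\<close> and \<open>b\<close> the largest component of \<open>x\<close>, for \<open>w\<^sub>n(p')\<close> take \<open>b = p'\<close> and
  \<open>a\<close> the \<open>(k+1)\<close>-st largest component of \<open>x\<close>, where \<open>k = \<lfloor>1/p'\<rfloor>\<close>. The degenerate positions are
  settled by certificates without entropy term.
\<close>

section \<open>Certificate functions: sums, continuity and derivative\<close>

text \<open>The weight \<open>c\<close> will be \<alpha> - 1 or 0. With \<alpha> - 1, one inequality
  serves both ranges of \<alpha>, as the sign of this factor reverses the entropy comparison for
  \<alpha> < 1. With 0, the sum over a vector is fixed by its total and its power sum alone.\<close>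

definition lagr :: "real \<Rightarrow> real \<Rightarrow> real \<Rightarrow> real \<Rightarrow> real \<Rightarrow> real" where
  "lagr c \<alpha> l m t = c * (- (t * ln t)) + l * t powr \<alpha> + m * t"

lemma lagr_0 [simp]: "lagr c \<alpha> l m 0 = 0"
  by (simp add: lagr_def)

lemma sum_lagr:
  "(\<Sum>i=1..n. lagr c \<alpha> l m (x i)) =
     c * shannon_entropy n x + l * (\<Sum>i=1..n. x i powr \<alpha>) + m * (\<Sum>i=1..n. x i)"
  by (simp add: lagr_def shannon_entropy_def sum.distrib sum_distrib_left sum_negf sum_subtractf)

text \<open>The derivative of the certificates is computed only for t > 0, so monotonicity on
  intervals starting at 0 rests on continuity at that endpoint.\<close>

lemma continuous_on_x_ln_x: "continuous_on {0..} (\<lambda>t::real. t * ln t)"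
proof (unfold continuous_on_def, intro ballI)
  fix t :: real assume t: "t \<in> {0..}"
  show "((\<lambda>t. t * ln t) \<longlongrightarrow> t * ln t) (at t within {0..})"
  proof (cases "t = 0")
    case True
    have "((\<lambda>t::real. t * ln t) \<longlongrightarrow> 0) (at_right 0)"
      by real_asymp
    moreover have "at 0 within {0..} = at_right (0::real)"
      by (rule at_within_Ici_at_right)
    ultimately show ?thesis using True by simp
  next
    case False
    then show ?thesis using t by (auto intro!: tendsto_intros)
  qed
qed

lemma continuous_on_lagr:
  assumes "\<alpha> > 0" "S \<subseteq> {0..}"
  shows "continuous_on S (lagr c \<alpha> l m)"
proof -
  have "continuous_on {0..} (\<lambda>t. lagr c \<alpha> l m t)"
    unfolding lagr_def using assms(1)
    by (intro continuous_intros continuous_on_x_ln_x continuous_on_powr') auto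
  then show ?thesis using assms(2) continuous_on_subset by blast
qed

lemma DERIV_lagr:
  assumes "t > 0"
  shows "(lagr c \<alpha> l m has_real_derivative
           - c * (ln t + 1) + l * \<alpha> * t powr (\<alpha> - 1) + m) (at t)"
  unfolding lagr_def [abs_def]
  by (rule derivative_eq_intros refl | use assms in \<open>simp add: algebra_simps\<close>)+

section \<open>Certificates with one or two prescribed critical points\<close>

text \<open>Taking \<open>l = \<alpha> - 1\<close> gives the power term the second derivative
  (\<alpha> - 1)^2 \<alpha> t^(\<alpha> - 2), positive on either side of \<alpha> = 1, and
  \<open>m\<close> cancels its slope at \<open>a\<close>. So \<open>a\<close> is the strict minimum
  on the nonnegative reals.\<close>

lemma lagr_tangent:
  fixes \<alpha> a :: real
  assumes "\<alpha> > 0" "\<alpha> \<noteq> 1" "a > 0"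
  obtains l m where
    "\<And>s t. \<lbrakk>0 \<le> s; s < t; t \<le> a\<rbrakk> \<Longrightarrow> lagr 0 \<alpha> l m t < lagr 0 \<alpha> l m s"
    "\<And>s t. \<lbrakk>a \<le> s; s < t\<rbrakk> \<Longrightarrow> lagr 0 \<alpha> l m s < lagr 0 \<alpha> l m t"
proof
  let ?l = "\<alpha> - 1" and ?m = "- ((\<alpha> - 1) * \<alpha> * a powr (\<alpha> - 1))"
  let ?h = "lagr 0 \<alpha> ?l ?m"
  have deriv: "(?h has_real_derivative (\<alpha> - 1) * \<alpha> * (t powr (\<alpha> - 1) - a powr (\<alpha> - 1))) (at t)"
    if "t > 0" for t
    using DERIV_lagr[OF that, of 0 \<alpha> ?l ?m] by (simp add: algebra_simps)
  have neg: "(\<alpha> - 1) * \<alpha> * (t powr (\<alpha> - 1) - a powr (\<alpha> - 1)) < 0" if "0 < t" "t < a" for t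
  proof (cases "\<alpha> > 1")
    case True
    then show ?thesis using that powr_less_mono2[of "\<alpha> - 1" t a] by (simp add: mult_less_0_iff)
  next
    case False
    then show ?thesis using that assms powr_less_mono2_neg[of "\<alpha> - 1" t a]
      by (simp add: mult_less_0_iff zero_less_mult_iff)
  qed
  have pos: "0 < (\<alpha> - 1) * \<alpha> * (t powr (\<alpha> - 1) - a powr (\<alpha> - 1))" if "a < t" for t
  proof (cases "\<alpha> > 1")
    case True
    then show ?thesis using that assms powr_less_mono2[of "\<alpha> - 1" a t]
      by (simp add: zero_less_mult_iff)
  next
    case False
    then show ?thesis using that assms powr_less_mono2_neg[of "\<alpha> - 1" a t]
      by (simp add: mult_less_0_iff zero_less_mult_iff)
  qed
  show "?h t < ?h s" if "0 \<le> s" "s < t" "t \<le> a" for s t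
  proof (rule DERIV_neg_imp_decreasing_open[OF \<open>s < t\<close>])
    show "\<exists>y. (?h has_real_derivative y) (at u) \<and> y < 0" if "s < u" "u < t" for u
      using that \<open>0 \<le> s\<close> \<open>t \<le> a\<close> deriv[of u] neg[of u] by (meson less_le_trans le_less_trans)
    show "continuous_on {s..t} ?h" using that assms by (intro continuous_on_lagr) auto
  qed
  show "?h s < ?h t" if "a \<le> s" "s < t" for s t
  proof (rule DERIV_pos_imp_increasing_open[OF \<open>s < t\<close>])
    show "\<exists>y. (?h has_real_derivative y) (at u) \<and> y > 0" if "s < u" "u < t" for u
      using that \<open>a \<le> s\<close> \<open>a > 0\<close> deriv[of u] pos[of u] by (meson less_trans le_less_trans)
    show "continuous_on {s..t} ?h" using that assms by (intro continuous_on_lagr) auto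
  qed
qed

lemma convex_on_two_zeros:
  fixes g :: "real \<Rightarrow> real"
  assumes g: "convex_on UNIV g" and ab: "a < b" and zero: "g a = 0" "g b = 0"
  shows "q \<le> a \<Longrightarrow> 0 \<le> g q" "a \<le> q \<Longrightarrow> q \<le> b \<Longrightarrow> g q \<le> 0" "b \<le> q \<Longrightarrow> 0 \<le> g q"
proof -
  \<comment> \<open>Three-point convexity with denominators cleared: putting the two zeros at two of
    the points leaves only the sign of \<open>g q\<close> to read off.\<close>
  have *: "(z - x) * g y \<le> (z - y) * g x + (y - x) * g z" if "x \<le> y" "y \<le> z" "x < z" for x y z
  proof -
    define u where "u = (y - x) / (z - x)"
    have u: "0 \<le> u" "u \<le> 1" and uy: "u * (z - x) = y - x"
      using that by (auto simp: u_def field_simps)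
    have y: "y = (1 - u) * x + u * z" using uy by (simp add: algebra_simps)
    have "g y \<le> (1 - u) * g x + u * g z"
      using convex_onD[OF g u, of x z] y by simp
    then have "(z - x) * g y \<le> (z - x) * ((1 - u) * g x + u * g z)"
      using that by (intro mult_left_mono) auto
    also have "\<dots> = ((z - x) - (z - x) * u) * g x + ((z - x) * u) * g z"
      by (simp add: algebra_simps)
    also have "(z - x) * u = y - x" using uy by (simp add: mult.commute)
    finally show ?thesis by (simp add: algebra_simps)
  qed
  show "q \<le> a \<Longrightarrow> 0 \<le> g q"
    using *[of q a b] ab zero by (auto simp: zero_le_mult_iff)
  show "a \<le> q \<Longrightarrow> q \<le> b \<Longrightarrow> g q \<le> 0"
    using *[of a q b] ab zero by (auto simp: mult_le_0_iff)
  show "b \<le> q \<Longrightarrow> 0 \<le> g q"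
    using *[of a b q] ab zero by (auto simp: zero_le_mult_iff)
qed

lemma convex_linear_plus_exp:
  fixes \<beta> \<kappa> d :: real
  assumes "\<kappa> \<ge> 0"
  shows "convex_on UNIV (\<lambda>q. - \<beta> * q + \<kappa> * exp (\<beta> * q) + d)"
proof (rule f''_ge0_imp_convex)
  show "((\<lambda>q. - \<beta> * q + \<kappa> * exp (\<beta> * q) + d) has_real_derivative
          - \<beta> + \<kappa> * (\<beta> * exp (\<beta> * q))) (at q)" for q
    by (auto intro!: derivative_eq_intros)
  show "((\<lambda>q. - \<beta> + \<kappa> * (\<beta> * exp (\<beta> * q))) has_real_derivative
          \<kappa> * (\<beta> * (\<beta> * exp (\<beta> * q)))) (at q)" for q
    by (auto intro!: derivative_eq_intros)
  have "0 \<le> \<kappa> * (\<beta> * \<beta> * exp (\<beta> * q))" for q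
    by (intro mult_nonneg_nonneg[OF assms] mult_nonneg_nonneg[OF zero_le_square] exp_ge_zero)
  then show "0 \<le> \<kappa> * (\<beta> * (\<beta> * exp (\<beta> * q)))" for q
    by (simp only: mult.assoc)
qed auto

lemma lagr_two_critical:
  fixes \<alpha> a b :: real
  assumes "\<alpha> > 0" "\<alpha> \<noteq> 1" "0 < a" "a < b"
  obtains l m where
    "\<And>s t. \<lbrakk>0 \<le> s; s \<le> t; t \<le> a\<rbrakk> \<Longrightarrow> lagr (\<alpha> - 1) \<alpha> l m s \<le> lagr (\<alpha> - 1) \<alpha> l m t"
    "\<And>s t. \<lbrakk>a \<le> s; s \<le> t; t \<le> b\<rbrakk> \<Longrightarrow> lagr (\<alpha> - 1) \<alpha> l m t \<le> lagr (\<alpha> - 1) \<alpha> l m s"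
    "\<And>s t. \<lbrakk>b \<le> s; s \<le> t\<rbrakk> \<Longrightarrow> lagr (\<alpha> - 1) \<alpha> l m s \<le> lagr (\<alpha> - 1) \<alpha> l m t"
proof
  define \<beta> where "\<beta> = \<alpha> - 1"
  \<comment> \<open>This \<kappa> solves \<open>g (ln a) = g (ln b)\<close>; then \<open>d\<close>
    shifts the common value to 0.\<close>
  define \<kappa> where "\<kappa> = \<beta> * (ln b - ln a) / (exp (\<beta> * ln b) - exp (\<beta> * ln a))"
  define d where "d = \<beta> * ln a - \<kappa> * exp (\<beta> * ln a)"
  define g where "g q = - \<beta> * q + \<kappa> * exp (\<beta> * q) + d" for q
  have \<beta>: "\<beta> \<noteq> 0" and ab: "ln a < ln b" using assms by (auto simp: \<beta>_def)
  have ne: "exp (\<beta> * ln b) - exp (\<beta> * ln a) \<noteq> 0" using \<beta> ab by simp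
  \<comment> \<open>Numerator and denominator both carry the sign of \<beta>.\<close>
  have "\<kappa> \<ge> 0"
  proof (cases "\<beta> > 0")
    case True
    then show ?thesis using ab by (simp add: \<kappa>_def)
  next
    case False
    then have "\<beta> * (ln b - ln a) \<le> 0" "exp (\<beta> * ln b) - exp (\<beta> * ln a) \<le> 0"
      using ab by (auto simp: mult_le_0_iff mult_left_mono_neg)
    then show ?thesis unfolding \<kappa>_def by (rule divide_nonpos_nonpos)
  qed
  then have "convex_on UNIV g" unfolding g_def by (rule convex_linear_plus_exp)
  moreover have "g (ln a) = 0" by (simp add: g_def d_def)
  moreover have "g (ln b) = 0"
  proof -
    have "g (ln b) = - (\<beta> * (ln b - ln a)) + \<kappa> * (exp (\<beta> * ln b) - exp (\<beta> * ln a))"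
      by (simp add: g_def d_def algebra_simps)
    then show ?thesis using ne by (simp add: \<kappa>_def)
  qed
  ultimately have sign: "q \<le> ln a \<Longrightarrow> 0 \<le> g q" "ln a \<le> q \<Longrightarrow> q \<le> ln b \<Longrightarrow> g q \<le> 0"
    "ln b \<le> q \<Longrightarrow> 0 \<le> g q" for q
    using convex_on_two_zeros[OF _ ab, of g q] by auto
  \<comment> \<open>The multipliers come from matching the derivative with \<open>g (ln t)\<close>:
    \<open>l * \<alpha> = \<kappa>\<close> for the exponential, \<open>m - \<beta> = d\<close> for
    the constant.\<close>
  let ?h = "lagr (\<alpha> - 1) \<alpha> (\<kappa> / \<alpha>) (d + \<beta>)"
  have deriv: "(?h has_real_derivative g (ln t)) (at t)" if "t > 0" for t
    using DERIV_lagr[OF that, of "\<alpha> - 1" \<alpha> "\<kappa> / \<alpha>" "d + \<beta>"] that assms(1)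
    by (simp add: g_def \<beta>_def powr_def algebra_simps)
  show "?h s \<le> ?h t" if "0 \<le> s" "s \<le> t" "t \<le> a" for s t
  proof (rule DERIV_nonneg_imp_increasing_open[OF \<open>s \<le> t\<close>])
    show "\<exists>y. (?h has_real_derivative y) (at u) \<and> y \<ge> 0" if "s < u" "u < t" for u
      using that \<open>0 \<le> s\<close> \<open>t \<le> a\<close> deriv[of u] sign(1)[of "ln u"]
      by (intro exI[of _ "g (ln u)"]) auto
    show "continuous_on {s..t} ?h" using that assms by (intro continuous_on_lagr) auto
  qed
  show "?h t \<le> ?h s" if "a \<le> s" "s \<le> t" "t \<le> b" for s t
  proof (rule DERIV_nonpos_imp_decreasing_open[OF \<open>s \<le> t\<close>])
    show "\<exists>y. (?h has_real_derivative y) (at u) \<and> y \<le> 0" if "s < u" "u < t" for u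
      using that \<open>a \<le> s\<close> \<open>t \<le> b\<close> \<open>0 < a\<close> deriv[of u] sign(2)[of "ln u"]
      by (intro exI[of _ "g (ln u)"]) auto
    show "continuous_on {s..t} ?h" using that assms by (intro continuous_on_lagr) auto
  qed
  show "?h s \<le> ?h t" if "b \<le> s" "s \<le> t" for s t
  proof (rule DERIV_nonneg_imp_increasing_open[OF \<open>s \<le> t\<close>])
    show "\<exists>y. (?h has_real_derivative y) (at u) \<and> y \<ge> 0" if "s < u" "u < t" for u
      using that \<open>b \<le> s\<close> \<open>0 < a\<close> \<open>a < b\<close> deriv[of u] sign(3)[of "ln u"]
      by (intro exI[of _ "g (ln u)"]) auto
    show "continuous_on {s..t} ?h" using that assms by (intro continuous_on_lagr) auto
  qed
qed

section \<open>Power sums, largest components, and vectors of power sum 1\<close>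

lemma alpha_norm_eq_iff:
  assumes "\<alpha> > 0"
  shows "alpha_norm n \<alpha> x = alpha_norm n \<alpha> y \<longleftrightarrow>
    (\<Sum>i=1..n. x i powr \<alpha>) = (\<Sum>i=1..n. y i powr \<alpha>)"
proof -
  have "(alpha_norm n \<alpha> z) powr \<alpha> = (\<Sum>i=1..n. z i powr \<alpha>)" for z
    using assms by (simp add: alpha_norm_def powr_powr sum_nonneg)
  then show ?thesis by (metis alpha_norm_def)
qed

lemma sum_v_vec:
  assumes "n \<ge> 1"
  shows "(\<Sum>i=1..n. f (v_vec n p i)) = f (1 - (real n - 1) * p) + (real n - 1) * (f p :: real)"
proof -
  have "(\<Sum>i=1..n. f (v_vec n p i)) = f (v_vec n p 1) + (\<Sum>i=Suc 1..n. f (v_vec n p i))"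
    using assms by (simp add: sum.atLeast_Suc_atMost)
  also have "(\<Sum>i=Suc 1..n. f (v_vec n p i)) = (\<Sum>i=Suc 1..n. f p)"
    by (rule sum.cong) (auto simp: v_vec_def)
  also have "\<dots> = (real n - 1) * f p" using assms by (simp add: of_nat_diff)
  finally show ?thesis by (simp add: v_vec_def)
qed

text \<open>For \<open>k = n\<close> the remainder component has index n + 1, outside the sum; the
  last two hypotheses then make its term on the right vanish.\<close>

lemma sum_w_vec:
  fixes f :: "real \<Rightarrow> real"
  assumes k: "\<lfloor>1 / p\<rfloor> = int k" and "k \<le> n" and "f 0 = 0" and "k = n \<Longrightarrow> 1 - real k * p = 0"
  shows "(\<Sum>i=1..n. f (w_vec p i)) = real k * f p + f (1 - real k * p)"
proof -
  have w: "w_vec p i = (if 1 \<le> i \<and> i \<le> k then p else if i = k + 1 then 1 - real k * p else 0)" for i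
    unfolding w_vec_def k by auto
  have low: "(\<Sum>i=1..k. f (w_vec p i)) = real k * f p" by (simp add: w)
  show ?thesis
  proof (cases "k = n")
    case True
    then show ?thesis using low assms by simp
  next
    case False
    have "(\<Sum>i=1..n. f (w_vec p i)) = (\<Sum>i=1..k+1. f (w_vec p i))"
      using False assms by (intro sum.mono_neutral_right) (auto simp: w)
    also have "\<dots> = real k * f p + f (1 - real k * p)" using low by (simp add: w)
    finally show ?thesis .
  qed
qed

text \<open>Stands in for sorting the components; the set grows by a maximum of what is
  left.\<close>

lemma ex_top_subset:
  fixes x :: "'a \<Rightarrow> real"
  assumes "finite A" "k \<le> card A"
  shows "\<exists>S\<subseteq>A. card S = k \<and> (\<forall>i\<in>S. \<forall>j\<in>A-S. x j \<le> x i)"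
  using assms(2)
proof (induction k)
  case 0
  show ?case by (intro exI[of _ "{}"]) auto
next
  case (Suc k)
  then obtain S where S: "S \<subseteq> A" "card S = k" "\<forall>i\<in>S. \<forall>j\<in>A-S. x j \<le> x i" by auto
  have fin: "finite (A - S)" "finite S" using assms S(1) finite_subset by auto
  have "A - S \<noteq> {}" using S Suc.prems by auto
  then obtain j where j: "j \<in> A - S" "\<forall>i\<in>A-S. x i \<le> x j"
    using fin Max_in[of "x ` (A - S)"] Max_ge[of "x ` (A - S)"] by fastforce
  then show ?case using S fin
    by (intro exI[of _ "insert j S"]) auto
qed

lemma entropy_compare:
  assumes "(\<Sum>i=1..n. x i powr \<alpha>) = (\<Sum>i=1..n. y i powr \<alpha>)"
    and "(\<Sum>i=1..n. x i) = (\<Sum>i=1..n. y i)"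
    and "(\<Sum>i=1..n. lagr c \<alpha> l m (x i)) \<le> (\<Sum>i=1..n. lagr c \<alpha> l m (y i))"
  shows "c * shannon_entropy n x \<le> c * shannon_entropy n y"
  using assms(3) unfolding sum_lagr assms(1,2) by simp

lemma prob_simplex_le_1:
  assumes "x \<in> prob_simplex n" "i \<in> {1..n}"
  shows "x i \<le> 1"
  using assms member_le_sum[of i "{1..n}" x] by (auto simp: prob_simplex_def)

text \<open>On [0,1] the terms (\<alpha> - 1)(t - t^\<alpha>) are nonnegative. Here they add up to
  0, so each vanishes and every component is 0 or 1. This settles \<open>p = 0\<close>, where no
  critical point can be placed at \<open>p\<close>.\<close>

lemma power_sum_eq_1_imp_entropy_0:
  assumes x: "x \<in> prob_simplex n" and \<alpha>: "\<alpha> > 0" "\<alpha> \<noteq> 1" and eq: "(\<Sum>i=1..n. x i powr \<alpha>) = 1"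
  shows "shannon_entropy n x = 0"
proof -
  define f where "f i = (\<alpha> - 1) * (x i - x i powr \<alpha>)" for i
  have "f i \<ge> 0" if "i \<in> {1..n}" for i
  proof (cases "x i = 0")
    case False
    then have xi: "0 < x i" "x i \<le> 1" using that x prob_simplex_le_1 by (auto simp: prob_simplex_def less_le)
    show ?thesis
    proof (cases "\<alpha> > 1")
      case True
      then show ?thesis using powr_mono'[of 1 \<alpha> "x i"] xi by (simp add: f_def)
    next
      case False
      then show ?thesis using powr_mono'[of \<alpha> 1 "x i"] xi by (simp add: f_def zero_le_mult_iff)
    qed
  qed (simp add: f_def)
  moreover have "(\<Sum>i=1..n. f i) = 0"
    using x eq by (simp add: f_def prob_simplex_def sum_subtractf flip: sum_distrib_left)
  ultimately have f0: "f i = 0" if "i \<in> {1..n}" for i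
    using sum_nonneg_eq_0_iff[of "{1..n}" f] that by auto
  have "x i * ln (x i) = 0" if "i \<in> {1..n}" for i
  proof (cases "x i = 0")
    case False
    then have "ln (x i powr \<alpha>) = ln (x i)" using f0[OF that] \<alpha> by (simp add: f_def)
    then show ?thesis using False \<alpha> by (simp add: ln_powr)
  qed simp
  then have "(\<Sum>i=1..n. x i * ln (x i)) = 0" by (intro sum.neutral) blast
  then show ?thesis by (simp add: shannon_entropy_def)
qed

section \<open>Comparison with \<open>v_vec\<close>\<close>

lemma entropy_v_vec:
  assumes n: "n \<ge> 2" and x: "x \<in> prob_simplex n" and \<alpha>: "\<alpha> > 0" "\<alpha> \<noteq> 1"
    and p: "0 \<le> p" "p \<le> 1 / real n"
    and eq: "(\<Sum>i=1..n. x i powr \<alpha>) = (\<Sum>i=1..n. v_vec n p i powr \<alpha>)"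
  shows "(\<alpha> - 1) * shannon_entropy n x \<le> (\<alpha> - 1) * shannon_entropy n (v_vec n p)"
proof (cases "p = 0")
  case True
  have "(\<Sum>i=1..n. v_vec n p i powr \<alpha>) = 1"
    using sum_v_vec[of n "\<lambda>t. t powr \<alpha>" p] n True by simp
  then have "shannon_entropy n x = 0"
    using eq x \<alpha> power_sum_eq_1_imp_entropy_0 by simp
  moreover have "shannon_entropy n (v_vec n p) = 0"
    using sum_v_vec[of n "\<lambda>t. t * ln t" p] n True by (simp add: shannon_entropy_def)
  ultimately show ?thesis by simp
next
  case False
  then have p0: "p > 0" using p by simp
  define M where "M = 1 - (real n - 1) * p"
  have x0: "x i \<ge> 0" if "i \<in> {1..n}" for i using x that by (auto simp: prob_simplex_def)
  have x1: "(\<Sum>i=1..n. x i) = 1" using x by (simp add: prob_simplex_def)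
  have np: "real n * p \<le> 1" using p n by (simp add: field_simps)
  have pM: "p \<le> M" using np by (simp add: M_def algebra_simps)
  have v1: "(\<Sum>i=1..n. v_vec n p i) = 1"
    using sum_v_vec[of n "\<lambda>t. t" p] n by simp
  obtain j where j: "j \<in> {1..n}" "\<forall>i\<in>{1..n}. x i \<le> x j"
    using n Max_in[of "x ` {1..n}"] Max_ge[of "x ` {1..n}"] by fastforce
  have split: "(\<Sum>i=1..n. f (x i)) = f (x j) + (\<Sum>i\<in>{1..n}-{j}. f (x i))" for f :: "real \<Rightarrow> real"
    using j by (simp add: sum.remove)
  have card: "real (card ({1..n} - {j})) = real n - 1" using j n by (simp add: of_nat_diff)
  \<comment> \<open>The largest component is at least the average 1/n.\<close>
  have pX: "p \<le> x j"
  proof -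
    have "1 \<le> real n * x j"
      using sum_bounded_above[of "{1..n}" x "x j"] j x1 by simp
    then have "real n * p \<le> real n * x j" using np by linarith
    then show ?thesis using n by simp
  qed
  \<comment> \<open>Otherwise the certificate with minimum at \<open>p\<close> has a larger sum over
    \<open>x\<close> than over \<open>v_vec n p\<close>: \<open>x j\<close> beats \<open>M\<close>
    strictly, and every other component gives at least the value at \<open>p\<close>. But equal
    totals and power sums force equal sums.\<close>
  have XM: "x j \<le> M"
  proof (rule ccontr)
    assume "\<not> x j \<le> M"
    obtain l m where
      dec: "\<And>s t. \<lbrakk>0 \<le> s; s < t; t \<le> p\<rbrakk> \<Longrightarrow> lagr 0 \<alpha> l m t < lagr 0 \<alpha> l m s" and
      inc: "\<And>s t. \<lbrakk>p \<le> s; s < t\<rbrakk> \<Longrightarrow> lagr 0 \<alpha> l m s < lagr 0 \<alpha> l m t"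
      using lagr_tangent[OF \<alpha> p0] by blast
    let ?h = "lagr 0 \<alpha> l m"
    have "?h p \<le> ?h t" if "0 \<le> t" for t
      using dec[of t p] inc[of p t] that by (cases t p rule: linorder_cases) auto
    then have "real (card ({1..n} - {j})) * ?h p \<le> (\<Sum>i\<in>{1..n}-{j}. ?h (x i))"
      using x0 by (intro sum_bounded_below) auto
    moreover have "?h M < ?h (x j)" using inc[of M "x j"] pM \<open>\<not> x j \<le> M\<close> by simp
    ultimately have "(\<Sum>i=1..n. ?h (v_vec n p i)) < (\<Sum>i=1..n. ?h (x i))"
      unfolding split M_def card using n by (subst sum_v_vec) auto
    then show False unfolding sum_lagr using eq v1 x1 by simp
  qed
  show ?thesis
  proof (cases "p = x j")
    \<comment> \<open>All components are at most \<open>p\<close>, and \<open>p\<close> is at most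
      1/n, so both vectors are uniform.\<close>
    case True
    have "(\<Sum>i=1..n. p - x i) \<le> 0" using x1 np by (simp add: sum_subtractf)
    moreover have "p - x i \<ge> 0" if "i \<in> {1..n}" for i using j True that by auto
    ultimately have "(\<Sum>i=1..n. p - x i) = 0" by (meson order_antisym sum_nonneg)
    then have *: "x i = p" if "i \<in> {1..n}" for i
      using sum_nonneg_eq_0_iff[of "{1..n}" "\<lambda>i. p - x i"] \<open>\<And>i. i \<in> {1..n} \<Longrightarrow> p - x i \<ge> 0\<close> that by auto
    then have "real n * p = 1" using x1 by simp
    then have "v_vec n p i = p" for i by (simp add: v_vec_def algebra_simps)
    then show ?thesis using * by (simp add: shannon_entropy_def)
  next
    case False
    then have "p < x j" using pX by simp
    from lagr_two_critical[OF \<alpha> p0 this] obtain l m where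
      h: "\<And>s t. \<lbrakk>0 \<le> s; s \<le> t; t \<le> p\<rbrakk> \<Longrightarrow> lagr (\<alpha> - 1) \<alpha> l m s \<le> lagr (\<alpha> - 1) \<alpha> l m t"
      "\<And>s t. \<lbrakk>p \<le> s; s \<le> t; t \<le> x j\<rbrakk> \<Longrightarrow> lagr (\<alpha> - 1) \<alpha> l m t \<le> lagr (\<alpha> - 1) \<alpha> l m s"
      "\<And>s t. \<lbrakk>x j \<le> s; s \<le> t\<rbrakk> \<Longrightarrow> lagr (\<alpha> - 1) \<alpha> l m s \<le> lagr (\<alpha> - 1) \<alpha> l m t"
      by blast
    let ?h = "lagr (\<alpha> - 1) \<alpha> l m"
    \<comment> \<open>On [0, \<open>x j\<close>] the certificate peaks at \<open>p\<close>, which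
      bounds the components other than \<open>x j\<close>; beyond \<open>x j\<close> it increases,
      which compares \<open>x j\<close> with \<open>M\<close>.\<close>
    have "?h t \<le> ?h p" if "0 \<le> t" "t \<le> x j" for t
      using h(1)[of t p] h(2)[of p t] that by (cases "t \<le> p") auto
    then have "(\<Sum>i\<in>{1..n}-{j}. ?h (x i)) \<le> real (card ({1..n} - {j})) * ?h p"
      using x0 j by (intro sum_bounded_above) auto
    moreover have "?h (x j) \<le> ?h M" using h(3) XM by simp
    ultimately have "(\<Sum>i=1..n. ?h (x i)) \<le> (\<Sum>i=1..n. ?h (v_vec n p i))"
      unfolding split M_def card using n by (subst sum_v_vec) auto
    then show ?thesis using eq v1 x1 by (intro entropy_compare) auto
  qed
qed

section \<open>Comparison with \<open>w_vec\<close>\<close>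

lemma entropy_w_vec:
  assumes n: "n \<ge> 1" and x: "x \<in> prob_simplex n" and \<alpha>: "\<alpha> > 0" "\<alpha> \<noteq> 1"
    and p: "1 / real n \<le> p" "p \<le> 1"
    and eq: "(\<Sum>i=1..n. x i powr \<alpha>) = (\<Sum>i=1..n. w_vec p i powr \<alpha>)"
  shows "(\<alpha> - 1) * shannon_entropy n (w_vec p) \<le> (\<alpha> - 1) * shannon_entropy n x"
proof -
  have p0: "p > 0" using p n by (smt (verit) divide_pos_pos of_nat_0_less_iff less_le_trans zero_less_one)
  define k where "k = nat \<lfloor>1 / p\<rfloor>"
  have k: "\<lfloor>1 / p\<rfloor> = int k" using p0 by (simp add: k_def)
  define r where "r = 1 - real k * p"
  have "real k \<le> 1 / p" "1 / p < real k + 1" using k by linarith+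
  then have kp: "real k * p \<le> 1" "1 < (real k + 1) * p" using p0 by (auto simp: field_simps)
  then have r: "0 \<le> r" "r < p" by (auto simp: r_def algebra_simps)
  have pn: "1 \<le> real n * p" using p n by (simp add: field_simps)
  then have "1 / p \<le> real n" using p0 by (simp add: field_simps)
  then have kn: "k \<le> n" using \<open>real k \<le> 1 / p\<close> by linarith
  have sum_w: "(\<Sum>i=1..n. f (w_vec p i)) = real k * f p + f r" if "f 0 = 0" for f :: "real \<Rightarrow> real"
    \<comment> \<open>If \<open>k = n\<close>, then n p is both at least and at most 1, so the
      remainder is 0.\<close>
    unfolding r_def using k kn that pn kp(1) by (intro sum_w_vec) auto
  have w1: "(\<Sum>i=1..n. w_vec p i) = 1"
    using sum_w[of "\<lambda>t. t"] by (simp add: r_def)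
  have x0: "x i \<ge> 0" if "i \<in> {1..n}" for i using x that by (auto simp: prob_simplex_def)
  have x1: "(\<Sum>i=1..n. x i) = 1" using x by (simp add: prob_simplex_def)
  obtain S where S: "S \<subseteq> {1..n}" "card S = k" "\<forall>i\<in>S. \<forall>j\<in>{1..n}-S. x j \<le> x i"
    using ex_top_subset[of "{1..n}" k x] kn by auto
  have finS: "finite S" using S(1) finite_subset by blast
  show ?thesis
  proof (cases "\<forall>i\<in>{1..n}-S. x i = 0")
    \<comment> \<open>No positive (k+1)-st component is available as a critical point. The
      entropy-free certificate has its minimum at \<open>p\<close> and value 0 at 0: the excess over
      \<open>S\<close> is nonnegative but equals \<open>?h r\<close>, which is negative unless
      \<open>r = 0\<close>. Hence \<open>r = 0\<close> and \<open>x\<close> equals \<open>p\<close>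
      on \<open>S\<close>.\<close>
    case True
    have sum_x: "(\<Sum>i=1..n. f (x i)) = (\<Sum>i\<in>S. f (x i))" if "f 0 = 0" for f :: "real \<Rightarrow> real"
      using True S(1) that by (intro sum.mono_neutral_right) auto
    obtain l m where
      dec: "\<And>s t. \<lbrakk>0 \<le> s; s < t; t \<le> p\<rbrakk> \<Longrightarrow> lagr 0 \<alpha> l m t < lagr 0 \<alpha> l m s" and
      inc: "\<And>s t. \<lbrakk>p \<le> s; s < t\<rbrakk> \<Longrightarrow> lagr 0 \<alpha> l m s < lagr 0 \<alpha> l m t"
      using lagr_tangent[OF \<alpha> p0] by blast
    let ?h = "lagr 0 \<alpha> l m"
    have hmin: "?h p < ?h t" if "0 \<le> t" "t \<noteq> p" for t
      using dec[of t p] inc[of p t] that by (cases t p rule: linorder_cases) auto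
    have hr: "?h r < 0" if "r \<noteq> 0" using dec[of 0 r] r that by simp
    have "(\<Sum>i=1..n. ?h (x i)) = (\<Sum>i=1..n. ?h (w_vec p i))"
      unfolding sum_lagr using eq x1 w1 by simp
    then have *: "(\<Sum>i\<in>S. ?h (x i) - ?h p) = ?h r"
      using S(2) sum_x[of ?h] sum_w[of ?h] by (simp add: sum_subtractf)
    have nonneg: "0 \<le> ?h (x i) - ?h p" if "i \<in> S" for i
      using hmin[of "x i"] x0 S(1) that by (cases "x i = p") (auto simp: less_imp_le)
    have "(\<Sum>i\<in>S. ?h (x i) - ?h p) \<ge> 0" using nonneg by (rule sum_nonneg)
    then have "r = 0" using hr * by linarith
    then have "\<forall>i\<in>S. ?h (x i) - ?h p = 0"
      using * nonneg finS sum_nonneg_eq_0_iff[of S "\<lambda>i. ?h (x i) - ?h p"] by simp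
    then have xp: "x i = p" if "i \<in> S" for i
      using hmin[of "x i"] that x0 S(1) by force
    have "shannon_entropy n x = shannon_entropy n (w_vec p)"
      using sum_x[of "\<lambda>t. t * ln t"] sum_w[of "\<lambda>t. t * ln t"] \<open>r = 0\<close> xp S(2)
      by (simp add: shannon_entropy_def)
    then show ?thesis by simp
  next
    case False
    then have "x ` ({1..n} - S) \<noteq> {}" by auto
    then obtain j where j: "j \<in> {1..n} - S" "\<forall>i\<in>{1..n}-S. x i \<le> x j"
      using Max_in[of "x ` ({1..n} - S)"] Max_ge[of "x ` ({1..n} - S)"] by fastforce
    have y0: "0 < x j" using False j x0 by (metis DiffD1 order_antisym not_le)
    have split: "(\<Sum>i=1..n. f (x i)) = (\<Sum>i\<in>S. f (x i)) + f (x j) + (\<Sum>i\<in>{1..n}-S-{j}. f (x i))"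
      for f :: "real \<Rightarrow> real"
    proof -
      have "(\<Sum>i=1..n. f (x i)) = (\<Sum>i\<in>S. f (x i)) + (\<Sum>i\<in>{1..n}-S. f (x i))"
        using S(1) by (simp add: sum.subset_diff)
      then show ?thesis using j by (simp add: sum.remove)
    qed
    \<comment> \<open>The k components in \<open>S\<close> and \<open>x j\<close> itself are all at
      least \<open>x j\<close>, so (k + 1) \<open>x j\<close> is at most 1, which is below (k + 1) p
      by the choice of k.\<close>
    have yp: "x j < p"
    proof -
      have "real k * x j \<le> (\<Sum>i\<in>S. x i)"
        using sum_bounded_below[of S "x j" x] S j by auto
      moreover have "0 \<le> (\<Sum>i\<in>{1..n}-S-{j}. x i)" using x0 by (intro sum_nonneg) auto
      ultimately have "(real k + 1) * x j \<le> 1"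
        using split[of "\<lambda>t. t"] x1 by (simp add: algebra_simps)
      then have "(real k + 1) * x j < (real k + 1) * p" using kp(2) by linarith
      then show ?thesis by (simp add: mult_less_cancel_left)
    qed
    from lagr_two_critical[OF \<alpha> y0 yp] obtain l m where
      h: "\<And>s t. \<lbrakk>0 \<le> s; s \<le> t; t \<le> x j\<rbrakk> \<Longrightarrow> lagr (\<alpha> - 1) \<alpha> l m s \<le> lagr (\<alpha> - 1) \<alpha> l m t"
      "\<And>s t. \<lbrakk>x j \<le> s; s \<le> t; t \<le> p\<rbrakk> \<Longrightarrow> lagr (\<alpha> - 1) \<alpha> l m t \<le> lagr (\<alpha> - 1) \<alpha> l m s"
      "\<And>s t. \<lbrakk>p \<le> s; s \<le> t\<rbrakk> \<Longrightarrow> lagr (\<alpha> - 1) \<alpha> l m s \<le> lagr (\<alpha> - 1) \<alpha> l m t"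
      by blast
    let ?h = "lagr (\<alpha> - 1) \<alpha> l m"
    \<comment> \<open>Three blocks: components in \<open>S\<close> lie above \<open>x j\<close>,
      where the minimum is at \<open>p\<close>; \<open>r\<close> lies in [0, p), where the maximum
      is at \<open>x j\<close>; the rest lie in [0, \<open>x j\<close>], where the value is at least
      \<open>?h 0 = 0\<close>.\<close>
    have "?h p \<le> ?h t" if "x j \<le> t" for t
      using h(2)[of t p] h(3)[of p t] that by (cases "t \<le> p") auto
    then have "real k * ?h p \<le> (\<Sum>i\<in>S. ?h (x i))"
      using sum_bounded_below[of S "?h p" "\<lambda>i. ?h (x i)"] S j by auto
    moreover have "?h r \<le> ?h (x j)"
      using h(1)[of r "x j"] h(2)[of "x j" r] r by (cases "r \<le> x j") auto
    moreover have "0 \<le> (\<Sum>i\<in>{1..n}-S-{j}. ?h (x i))"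
      using h(1)[of 0] x0 j by (intro sum_nonneg) auto
    ultimately have "(\<Sum>i=1..n. ?h (w_vec p i)) \<le> (\<Sum>i=1..n. ?h (x i))"
      unfolding split by (subst sum_w) auto
    then show ?thesis using eq w1 x1 by (intro entropy_compare) auto
  qed
qed

theorem theorem2:
  fixes n :: nat and x :: "nat \<Rightarrow> real" and \<alpha> p p' :: real
  assumes "n \<ge> 2"
    and "x \<in> prob_simplex n"
    and "\<alpha> \<in> {0<..<1} \<union> {1<..}"
    and "p \<in> {0..1 / real n}"
    and "p' \<in> {1 / real n..1}"
    and "alpha_norm n \<alpha> (v_vec n p) = alpha_norm n \<alpha> x"
    and "alpha_norm n \<alpha> x = alpha_norm n \<alpha> (w_vec p')"
  shows "(0 < \<alpha> \<and> \<alpha> < 1 \<longrightarrow>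
            shannon_entropy n (v_vec n p) \<le> shannon_entropy n x \<and>
            shannon_entropy n x \<le> shannon_entropy n (w_vec p'))
       \<and> (\<alpha> > 1 \<longrightarrow>
            shannon_entropy n (w_vec p') \<le> shannon_entropy n x \<and>
            shannon_entropy n x \<le> shannon_entropy n (v_vec n p))"
proof -
  have \<alpha>: "\<alpha> > 0" "\<alpha> \<noteq> 1" using assms(3) by auto
  have "(\<alpha> - 1) * shannon_entropy n x \<le> (\<alpha> - 1) * shannon_entropy n (v_vec n p)"
    using assms \<alpha> alpha_norm_eq_iff[OF \<alpha>(1), of n "v_vec n p" x] by (intro entropy_v_vec) auto
  moreover have "(\<alpha> - 1) * shannon_entropy n (w_vec p') \<le> (\<alpha> - 1) * shannon_entropy n x"
    using assms \<alpha> alpha_norm_eq_iff[OF \<alpha>(1), of n x "w_vec p'"] by (intro entropy_w_vec) auto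
  \<comment> \<open>Cancelling \<alpha> - 1 keeps both inequalities for \<alpha> > 1 and reverses
    them for \<alpha> < 1.\<close>
  ultimately show ?thesis by (auto simp: mult_le_cancel_left)
qed

end
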